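(* Let $\mathcal{I}$ be a proper ideal on $\mathbf{N}$ and let $\mu=(\mu_n)_{n\in\mathbf{N}}$ be a smooth sequence of submeasures. Then there exists a unique (not necessarily proper) ideal $\mathcal{J}=\mathcal{J}(\mathcal{I},\mu)$ on $\mathbf{N}$ such that $(\mathcal{I},\mu)$-convergence coincides with $\mathcal{J}$-convergence. In addition, $\mathcal{J}$ is proper if and only if $\mu_n(\mathbf{N})\not\to_{\mathcal{I}} 0$.
   Context: $\mathbf{N}$ denotes the positive integers. An ideal on $\mathbf{N}$ is a family $\mathcal{I}\subseteq\mathcal{P}(\mathbf{N})$ closed under finite unions and subsets and containing all finite subsets of $\mathbf{N}$; it is proper if $\mathcal{I}\neq\mathcal{P}(\mathbf{N})$. For an ideal $\mathcal{J}$ (proper or not), a sequence $(x_n)$ in a Hausdorff space $X$ is $\mathcal{J}$-convergent to $\ell\in X$, written $x_n\to_{\mathcal{J}}\ell$, if $\{n\in\mathbf{N}: x_n\notin U\}\in\mathcal{J}$ for all neighborhoods $U$ of $\ell$ (the same notation is used for the $[0,\infty]$-valued sequence $(\mu_n(A))_n$ and limit $0$: $\mu_n(A)\to_{\mathcal{I}}0$ means $\{n:\mu_n(A)\ge\varepsilon\}\in\mathcal{I}$ for all $\varepsilon>0$). A submeasure is a map $\varphi:\mathcal{P}(\mathbf{N})\to[0,\infty]$ such that $\varphi(\emptyset)=0$, $\varphi(A)\le\varphi(B)$ if $A\subseteq B$, $\varphi(A\cup B)\le\varphi(A)+\varphi(B)$, and $\varphi(\{n\})<\infty$ for all $n\in\mathbf{N}$.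 A sequence of submeasures $\mu=(\mu_n)$ is smooth if: (S1) for all $n$, $\mu_n$ is supported on a nonempty set $I_n\subseteq\mathbf{N}$ (i.e. $\mu_n(A)=\mu_n(A\cap I_n)$ for all $A\subseteq\mathbf{N}$); (S2) $\lim_{n\to\infty}\mu_n(\{k\})=0$ for all $k\in\mathbf{N}$; (S3) $\limsup_{n\to\infty}\mu_n(\mathbf{N})>0$. A sequence $(x_n)$ in a Hausdorff space $X$ is $(\mathcal{I},\mu)$-convergent to $\ell\in X$ if $\mu_n(\{k\in\mathbf{N}:x_k\notin U\})\to_{\mathcal{I}}0$ for each neighborhood $U$ of $\ell$, i.e. $\{n\in\mathbf{N}:\mu_n(\{k\in\mathbf{N}:x_k\notin U\})\ge\varepsilon\}\in\mathcal{I}$ for each neighborhood $U$ of $\ell$ and each $\varepsilon>0$. One says that $(\mathcal{I},\mu)$-convergence coincides with $\mathcal{J}$-convergence if, for some Hausdorff space $X$ with at least two points, every sequence $(x_n)$ taking values in $X$ is $(\mathcal{I},\mu)$-convergent to $\ell\in X$ if and only if it is $\mathcal{J}$-convergent to $\ell$. *)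

theory Defs
  imports "HOL-Analysis.Analysis"
begin

abbreviation Npos :: "nat set" where
  "Npos \<equiv> {1..}"

definition ideal_on_N :: "nat set set \<Rightarrow> bool" where
  "ideal_on_N I \<longleftrightarrow>
     I \<subseteq> Pow Npos \<and>
     (\<forall>A\<in>I. \<forall>B\<in>I. A \<union> B \<in> I) \<and>
     (\<forall>B\<in>I. \<forall>A. A \<subseteq> B \<longrightarrow> A \<in> I) \<and>
     (\<forall>A. A \<subseteq> Npos \<and> finite A \<longrightarrow> A \<in> I)"

definition proper_ideal_on_N :: "nat set set \<Rightarrow> bool" where
  "proper_ideal_on_N I \<longleftrightarrow> ideal_on_N I \<and> I \<noteq> Pow Npos"

text \<open>Submeasures are total functions on \<^typ>\<open>nat set\<close>, but only their values on subsets of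
  the positive integers matter; likewise, sequences are functions on \<^typ>\<open>nat\<close> whose value
  at \<open>0\<close> is never used.\<close>

definition submeasure :: "(nat set \<Rightarrow> ennreal) \<Rightarrow> bool" where
  "submeasure \<phi> \<longleftrightarrow>
     \<phi> {} = 0 \<and>
     (\<forall>A B. A \<subseteq> B \<and> B \<subseteq> Npos \<longrightarrow> \<phi> A \<le> \<phi> B) \<and>
     (\<forall>A B. A \<subseteq> Npos \<and> B \<subseteq> Npos \<longrightarrow> \<phi> (A \<union> B) \<le> \<phi> A + \<phi> B) \<and>
     (\<forall>n\<in>Npos. \<phi> {n} < \<infinity>)"

definition smooth_submeasures :: "(nat \<Rightarrow> nat set \<Rightarrow> ennreal) \<Rightarrow> bool" where
  "smooth_submeasures \<mu> \<longleftrightarrow>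
     (\<forall>n\<in>Npos. submeasure (\<mu> n)) \<and>
     (\<forall>n\<in>Npos. \<exists>S. S \<noteq> {} \<and> S \<subseteq> Npos \<and> (\<forall>A. A \<subseteq> Npos \<longrightarrow> \<mu> n A = \<mu> n (A \<inter> S))) \<and>
     (\<forall>k\<in>Npos. (\<lambda>n. \<mu> n {k}) \<longlonglongrightarrow> 0) \<and>
     limsup (\<lambda>n. \<mu> n Npos) > 0"

definition nbhd :: "'a topology \<Rightarrow> 'a \<Rightarrow> 'a set \<Rightarrow> bool" where
  "nbhd X l U \<longleftrightarrow> U \<subseteq> topspace X \<and> (\<exists>V. openin X V \<and> l \<in> V \<and> V \<subseteq> U)"

definition ideal_convergent :: "'a topology \<Rightarrow> nat set set \<Rightarrow> (nat \<Rightarrow> 'a) \<Rightarrow> 'a \<Rightarrow> bool" where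
  "ideal_convergent X J x l \<longleftrightarrow> (\<forall>U. nbhd X l U \<longrightarrow> {n\<in>Npos. x n \<notin> U} \<in> J)"

definition ideal_null :: "nat set set \<Rightarrow> (nat \<Rightarrow> ennreal) \<Rightarrow> bool" where
  "ideal_null I a \<longleftrightarrow> (\<forall>\<epsilon>::real. \<epsilon> > 0 \<longrightarrow> {n\<in>Npos. a n \<ge> ennreal \<epsilon>} \<in> I)"

definition submeasure_convergent ::
  "'a topology \<Rightarrow> nat set set \<Rightarrow> (nat \<Rightarrow> nat set \<Rightarrow> ennreal) \<Rightarrow> (nat \<Rightarrow> 'a) \<Rightarrow> 'a \<Rightarrow> bool" where
  "submeasure_convergent X I \<mu> x l \<longleftrightarrow>
     (\<forall>U. nbhd X l U \<longrightarrow> ideal_null I (\<lambda>n. \<mu> n {k\<in>Npos. x k \<notin> U}))"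

text \<open>HOL cannot quantify over types inside a formula, so ``for some Hausdorff space'' is
  expressed relative to a carrier type: \<open>X\<close> ranges over all Hausdorff spaces whose points
  form a subset of \<^typ>\<open>'a\<close>.\<close>

definition convergence_coincides ::
  "'a itself \<Rightarrow> nat set set \<Rightarrow> (nat \<Rightarrow> nat set \<Rightarrow> ennreal) \<Rightarrow> nat set set \<Rightarrow> bool" where
  "convergence_coincides (_ :: 'a itself) I \<mu> J \<longleftrightarrow>
     (\<exists>X :: 'a topology.
        Hausdorff_space X \<and>
        (\<exists>p\<in>topspace X. \<exists>q\<in>topspace X. p \<noteq> q) \<and>
        (\<forall>x. (\<forall>n\<in>Npos. x n \<in> topspace X) \<longrightarrow>
           (\<forall>l\<in>topspace X. submeasure_convergent X I \<mu> x l \<longleftrightarrow> ideal_convergent X J x l)))"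

end

theory Submission
  imports Defs
begin

text \<open>The ideal is \<open>J = {A. \<mu>\<^sub>n(A) \<rightarrow>\<^sub>I 0}\<close>: unfolding the definitions,
  \<open>(I, \<mu>)\<close>-convergence is \<open>J\<close>-convergence in every space. Conversely, an ideal can be
  recovered from its convergent sequences in any Hausdorff space with two points \<open>p \<noteq> q\<close>,
  since the sequence equal to \<open>q\<close> on \<open>A\<close> and to \<open>p\<close> off \<open>A\<close> converges to \<open>p\<close> exactly when
  \<open>A\<close> lies in the ideal.\<close>

definition null_ideal :: "nat set set \<Rightarrow> (nat \<Rightarrow> nat set \<Rightarrow> ennreal) \<Rightarrow> nat set set" where
  "null_ideal I \<mu> = {A. A \<subseteq> Npos \<and> ideal_null I (\<lambda>n. \<mu> n A)}"

lemma ideal_on_N_subset: "ideal_on_N I \<Longrightarrow> B \<in> I \<Longrightarrow> A \<subseteq> B \<Longrightarrow> A \<in> I"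
  unfolding ideal_on_N_def by blast

lemma ideal_on_N_Un: "ideal_on_N I \<Longrightarrow> A \<in> I \<Longrightarrow> B \<in> I \<Longrightarrow> A \<union> B \<in> I"
  unfolding ideal_on_N_def by blast

lemma ideal_on_N_finite: "ideal_on_N I \<Longrightarrow> A \<subseteq> Npos \<Longrightarrow> finite A \<Longrightarrow> A \<in> I"
  unfolding ideal_on_N_def by blast

lemma ideal_on_N_eq_Pow_iff: "ideal_on_N I \<Longrightarrow> I = Pow Npos \<longleftrightarrow> Npos \<in> I"
  unfolding ideal_on_N_def by blast

lemma ideal_null_mono:
  assumes "ideal_on_N I" "ideal_null I b" "\<And>n. n \<in> Npos \<Longrightarrow> a n \<le> b n"
  shows "ideal_null I a"
  unfolding ideal_null_def
proof (intro allI impI)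
  fix \<epsilon> :: real
  assume "\<epsilon> > 0"
  then have "{n \<in> Npos. b n \<ge> ennreal \<epsilon>} \<in> I"
    using assms(2) by (simp add: ideal_null_def)
  moreover have "{n \<in> Npos. a n \<ge> ennreal \<epsilon>} \<subseteq> {n \<in> Npos. b n \<ge> ennreal \<epsilon>}"
    using assms(3) by (auto intro: order_trans)
  ultimately show "{n \<in> Npos. a n \<ge> ennreal \<epsilon>} \<in> I"
    using ideal_on_N_subset[OF assms(1)] by blast
qed

text \<open>A sum reaching \<open>\<epsilon>\<close> has a summand reaching
  \<open>\<epsilon>/2\<close>, so the exceptional set of the sum is covered by the union of two
  members of the ideal.\<close>

lemma ideal_null_add:
  assumes "ideal_on_N I" "ideal_null I a" "ideal_null I b"
  shows "ideal_null I (\<lambda>n. a n + b n)"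
  unfolding ideal_null_def
proof (intro allI impI)
  fix \<epsilon> :: real
  assume "\<epsilon> > 0"
  then have "{n \<in> Npos. a n \<ge> ennreal (\<epsilon>/2)} \<union> {n \<in> Npos. b n \<ge> ennreal (\<epsilon>/2)} \<in> I"
    using assms by (intro ideal_on_N_Un) (simp_all add: ideal_null_def)
  moreover have "a n \<ge> ennreal (\<epsilon>/2) \<or> b n \<ge> ennreal (\<epsilon>/2)"
    if "a n + b n \<ge> ennreal \<epsilon>" for n
  proof (rule ccontr)
    assume "\<not> ?thesis"
    then have "a n + b n < ennreal (\<epsilon>/2) + ennreal (\<epsilon>/2)"
      by (intro add_strict_mono) auto
    also have "\<dots> = ennreal \<epsilon>"
      using \<open>\<epsilon> > 0\<close> by (simp flip: ennreal_plus)
    finally show False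
      using that by simp
  qed
  then have "{n \<in> Npos. a n + b n \<ge> ennreal \<epsilon>}
      \<subseteq> {n \<in> Npos. a n \<ge> ennreal (\<epsilon>/2)} \<union> {n \<in> Npos. b n \<ge> ennreal (\<epsilon>/2)}"
    by blast
  ultimately show "{n \<in> Npos. a n + b n \<ge> ennreal \<epsilon>} \<in> I"
    using ideal_on_N_subset[OF assms(1)] by blast
qed

lemma ideal_null_of_tendsto_0:
  assumes "ideal_on_N I" "a \<longlonglongrightarrow> 0"
  shows "ideal_null I a"
  unfolding ideal_null_def
proof (intro allI impI)
  fix \<epsilon> :: real
  assume "\<epsilon> > 0"
  then have "\<forall>\<^sub>F n in sequentially. a n < ennreal \<epsilon>"
    by (intro order_tendstoD(2)[OF assms(2)]) simp
  then have "finite {n. \<not> a n < ennreal \<epsilon>}"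
    \<comment> \<open>On \<open>nat\<close> the sequential filter is the cofinite one, so an
      eventual bound fails at finitely many indices only.\<close>
    by (simp add: eventually_cofinite flip: cofinite_eq_sequentially)
  then have "finite {n \<in> Npos. a n \<ge> ennreal \<epsilon>}"
    by (rule rev_finite_subset) auto
  then show "{n \<in> Npos. a n \<ge> ennreal \<epsilon>} \<in> I"
    by (intro ideal_on_N_finite[OF assms(1)]) auto
qed

text \<open>Each closure property mirrors one assumption: unions come from subadditivity, subsets
  from monotonicity, and finite sets from the pointwise limits \<open>lim\<close> at
  singletons.\<close>

lemma ideal_on_N_null_ideal:
  assumes I: "ideal_on_N I"
    and sub: "\<And>n. n \<in> Npos \<Longrightarrow> submeasure (\<mu> n)"
    and lim: "\<And>k. k \<in> Npos \<Longrightarrow> (\<lambda>n. \<mu> n {k}) \<longlonglongrightarrow> 0"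
  shows "ideal_on_N (null_ideal I \<mu>)"
proof -
  have Un: "A \<union> B \<in> null_ideal I \<mu>" if "A \<in> null_ideal I \<mu>" "B \<in> null_ideal I \<mu>" for A B
  proof -
    have "ideal_null I (\<lambda>n. \<mu> n A + \<mu> n B)"
      using that by (intro ideal_null_add I) (simp_all add: null_ideal_def)
    moreover have "\<mu> n (A \<union> B) \<le> \<mu> n A + \<mu> n B" if "n \<in> Npos" for n
      using sub[OF that] \<open>A \<in> _\<close> \<open>B \<in> _\<close> by (auto simp: null_ideal_def submeasure_def)
    ultimately have "ideal_null I (\<lambda>n. \<mu> n (A \<union> B))"
      by (rule ideal_null_mono[OF I])
    then show ?thesis
      using that by (simp add: null_ideal_def)
  qed
  have mono: "A \<in> null_ideal I \<mu>" if "B \<in> null_ideal I \<mu>" "A \<subseteq> B" for A B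
  proof -
    have "B \<subseteq> Npos" "ideal_null I (\<lambda>n. \<mu> n B)"
      using that by (simp_all add: null_ideal_def)
    moreover have "\<mu> n A \<le> \<mu> n B" if "n \<in> Npos" for n
      using sub[OF that] \<open>A \<subseteq> B\<close> \<open>B \<subseteq> Npos\<close> by (simp add: submeasure_def)
    ultimately have "ideal_null I (\<lambda>n. \<mu> n A)"
      by (blast intro: ideal_null_mono[OF I])
    then show ?thesis
      using \<open>A \<subseteq> B\<close> \<open>B \<subseteq> Npos\<close> by (auto simp: null_ideal_def)
  qed
  have finite: "A \<in> null_ideal I \<mu>" if "finite A" "A \<subseteq> Npos" for A
    using that
  proof (induction A rule: finite_induct)
    case empty
    have "ideal_null I (\<lambda>n. 0)"
      by (rule ideal_null_of_tendsto_0[OF I]) simp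
    then have "ideal_null I (\<lambda>n. \<mu> n {})"
      by (rule ideal_null_mono[OF I]) (use sub in \<open>simp add: submeasure_def\<close>)
    then show ?case
      by (simp add: null_ideal_def)
  next
    case (insert k A)
    \<comment> \<open>Ordinary convergence to 0 implies \<open>I\<close>-convergence to 0 because
      \<open>I\<close> contains all finite sets.\<close>
    then have "{k} \<in> null_ideal I \<mu>"
      using ideal_null_of_tendsto_0[OF I lim] by (simp add: null_ideal_def)
    then show ?case
      using Un[of "{k}" A] insert by simp
  qed
  have "null_ideal I \<mu> \<subseteq> Pow Npos"
    by (auto simp: null_ideal_def)
  with Un mono finite show ?thesis
    unfolding ideal_on_N_def by blast
qed

text \<open>For each neighborhood \<open>U\<close>, both sides impose the same condition on the
  exceptional set of indices \<open>k\<close> with \<open>x k \<notin> U\<close>, which lies in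
  \<open>Npos\<close> by construction.\<close>

lemma submeasure_convergent_iff_null_ideal:
  "submeasure_convergent X I \<mu> x l \<longleftrightarrow> ideal_convergent X (null_ideal I \<mu>) x l"
  unfolding submeasure_convergent_def ideal_convergent_def null_ideal_def by auto

text \<open>The two convergences agree in every space, so it suffices to exhibit one Hausdorff space
  with two points: the whole type with the discrete topology.\<close>

lemma convergence_coincides_null_ideal:
  assumes "\<exists>p q :: 'a. p \<noteq> q"
  shows "convergence_coincides TYPE('a) I \<mu> (null_ideal I \<mu>)"
  unfolding convergence_coincides_def submeasure_convergent_iff_null_ideal
  by (rule exI[of _ "discrete_topology UNIV"])
    (use assms in \<open>auto simp: Hausdorff_space_discrete_topology\<close>)

lemma ideal_convergent_two_valued_iff:
  assumes J: "ideal_on_N J" and X: "Hausdorff_space X"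
    and pq: "p \<in> topspace X" "q \<in> topspace X" "p \<noteq> q" and A: "A \<subseteq> Npos"
  shows "ideal_convergent X J (\<lambda>n. if n \<in> A then q else p) p \<longleftrightarrow> A \<in> J"
proof
  \<comment> \<open>A neighborhood of \<open>p\<close> that misses \<open>q\<close> has exactly
    \<open>A\<close> as its exceptional set; in the converse direction any neighborhood of
    \<open>p\<close> leaves at most \<open>A\<close>.\<close>
  obtain U where U: "openin X U" "p \<in> U" "q \<notin> U"
    using X pq unfolding Hausdorff_space_def disjnt_iff by metis
  then have "nbhd X p U"
    by (auto simp: nbhd_def dest: openin_subset)
  moreover assume "ideal_convergent X J (\<lambda>n. if n \<in> A then q else p) p"
  ultimately have "{n \<in> Npos. (if n \<in> A then q else p) \<notin> U} \<in> J"
    by (simp add: ideal_convergent_def)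
  also have "{n \<in> Npos. (if n \<in> A then q else p) \<notin> U} = A"
    using U A by auto
  finally show "A \<in> J" .
next
  assume "A \<in> J"
  show "ideal_convergent X J (\<lambda>n. if n \<in> A then q else p) p"
    unfolding ideal_convergent_def
  proof (intro allI impI)
    fix U
    assume "nbhd X p U"
    then have "p \<in> U"
      by (auto simp: nbhd_def)
    then have "{n \<in> Npos. (if n \<in> A then q else p) \<notin> U} \<subseteq> A"
      by auto
    then show "{n \<in> Npos. (if n \<in> A then q else p) \<notin> U} \<in> J"
      by (rule ideal_on_N_subset[OF J \<open>A \<in> J\<close>])
  qed
qed

lemma convergence_coincides_imp_eq_null_ideal:
  assumes J: "ideal_on_N J" and N: "ideal_on_N (null_ideal I \<mu>)"
    and coincides: "convergence_coincides TYPE('b) I \<mu> J"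
  shows "J = null_ideal I \<mu>"
proof -
  obtain X :: "'b topology" and p q where X: "Hausdorff_space X"
    and pq: "p \<in> topspace X" "q \<in> topspace X" "p \<noteq> q"
    and eq: "\<And>x l. \<forall>n\<in>Npos. x n \<in> topspace X \<Longrightarrow> l \<in> topspace X \<Longrightarrow>
      ideal_convergent X (null_ideal I \<mu>) x l \<longleftrightarrow> ideal_convergent X J x l"
    using coincides
    unfolding convergence_coincides_def submeasure_convergent_iff_null_ideal by blast
  \<comment> \<open>Testing \<open>eq\<close> on the two-valued sequence of \<open>A\<close> with
    limit \<open>p\<close> turns both of its sides into membership of \<open>A\<close>.\<close>
  have "A \<in> J \<longleftrightarrow> A \<in> null_ideal I \<mu>" if "A \<subseteq> Npos" for A
    using eq[of "\<lambda>n. if n \<in> A then q else p" p] pq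
    by (simp add: ideal_convergent_two_valued_iff[OF J X pq that]
        ideal_convergent_two_valued_iff[OF N X pq that])
  moreover have "J \<subseteq> Pow Npos" "null_ideal I \<mu> \<subseteq> Pow Npos"
    using J N by (simp_all add: ideal_on_N_def)
  ultimately show ?thesis
    by blast
qed

text \<open>Existence and uniqueness use independent carrier types \<open>'a\<close> and
  \<open>'b\<close>, so an ideal obtained from a space over another type is still the same one. The
  third assumption lets \<open>'a\<close> carry a space with two points.\<close>

theorem theorem2p3:
  fixes I :: "nat set set" and \<mu> :: "nat \<Rightarrow> nat set \<Rightarrow> ennreal"
  assumes "proper_ideal_on_N I"
    and "smooth_submeasures \<mu>"
    and "\<exists>p q :: 'a. p \<noteq> q"
  shows "\<exists>J. ideal_on_N J \<and> convergence_coincides TYPE('a) I \<mu> J \<and>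
           (\<forall>J'. ideal_on_N J' \<and> convergence_coincides TYPE('b) I \<mu> J' \<longrightarrow> J' = J) \<and>
           (proper_ideal_on_N J \<longleftrightarrow> \<not> ideal_null I (\<lambda>n. \<mu> n Npos))"
proof (intro exI conjI allI impI)
  show J: "ideal_on_N (null_ideal I \<mu>)"
    using assms(1,2) unfolding proper_ideal_on_N_def smooth_submeasures_def
    by (intro ideal_on_N_null_ideal) blast+
  show "convergence_coincides TYPE('a) I \<mu> (null_ideal I \<mu>)"
    by (rule convergence_coincides_null_ideal[OF assms(3)])
  show "J' = null_ideal I \<mu>" if "ideal_on_N J' \<and> convergence_coincides TYPE('b) I \<mu> J'" for J'
    using convergence_coincides_imp_eq_null_ideal[OF _ J] that by blast
  \<comment> \<open>An ideal is improper exactly when it contains \<open>Npos\<close>, and for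
    \<open>null_ideal\<close> this membership is the nullity of \<open>\<mu> n Npos\<close>.\<close>
  show "proper_ideal_on_N (null_ideal I \<mu>) \<longleftrightarrow> \<not> ideal_null I (\<lambda>n. \<mu> n Npos)"
    using J ideal_on_N_eq_Pow_iff[OF J] by (simp add: proper_ideal_on_N_def null_ideal_def)
qed

end
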